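(* The semi-coarse MILP is a tightening of the original MILP (both defined in the context), and its optimal value is an upper bound on the optimal value of the original MILP: $z^\star_{\rm MILP}\le z^\star_{\rm semi}$. Moreover, the two problems are equivalent if the optimal profiles from a solution of the original MILP are included in the semi-coarse MILP. That is: if $(y^\star,x^\star,v^\star,w^\star)$ is an optimal solution of the original MILP such that for every $i\in\{1,\dots,n\}$ there exist $k\in\{1,\dots,K\}$ and $j\in\{1,\dots,I_k\}$ with $\bar X_k=x_i^\star$ and $\bar V_{jk}=v_i^\star$, and there exists $j'\in\{1,\dots,J\}$ with $\bar W_{j'}=w_i^\star$, then the original MILP and the semi-coarse MILP are equivalent.
   Context: All vector inequalities are componentwise. Original MILP. Let $m,N,M$ be positive integers, $a\in\mathbb{R}^m$, $b,c,d\in\mathbb{R}^N$, $f\in\mathbb{R}^M$, $A\in\mathbb{R}^{M\times m}$, $B,C,D\in\mathbb{R}^{M\times N}$, and let $L\le U$ be finite real bounds. The original MILP is: minimize $a^Ty+b^Tx+c^Tv+d^Tw$ subject to $Ay+Bx+Cv+Dw\le f$, $y\in\{0,1\}^m$, $x\in\{0,1\}^N$, $v\in\mathbb{R}^N$ with $Lx\le v\le Ux$, and $w\in\mathbb{R}^N$ with $w\ge 0$. Partition. Let $\delta$ be a positive integer with $N=n\delta$. Vectors $x,v,w,b,c,d\in\mathbb{R}^N$ are split into $n$ consecutive blocks of length $\delta$, e.g. $x=(x_1,\dots,x_n)$ with $x_i\in\mathbb{R}^\delta$. The matrices are split into column blocks, $B=[B_1:\cdots:B_n]$, $C=[C_1:\cdots:C_n]$,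 $D=[D_1:\cdots:D_n]$ with $B_i,C_i,D_i\in\mathbb{R}^{M\times\delta}$. Profiles. Fixed data: $\bar X_k\in\{0,1\}^\delta$ for $k=1,\dots,K$; for each $k$, vectors $\bar V_{jk}\in\mathbb{R}^\delta$ with $L\bar X_k\le\bar V_{jk}\le U\bar X_k$ for $j=1,\dots,I_k$; and vectors $\bar W_j\in\mathbb{R}^\delta$ with $\bar W_j\ge0$ for $j=1,\dots,J$. Let $\bar X$, $\bar V$, $\bar W$ be the matrices whose columns are, respectively, all $\bar X_k$, all $\bar V_{jk}$ (ordered by $k$, then $j$), and all $\bar W_j$. Aggregated data. $\bar B=[B_1\bar X:\cdots:B_n\bar X]$, $\bar C=[C_1\bar V:\cdots:C_n\bar V]$, $\bar D=[D_1\bar W:\cdots:D_n\bar W]$, and $\bar b=[b_1^T\bar X:\cdots:b_n^T\bar X]^T$, $\bar c=[c_1^T\bar V:\cdots:c_n^T\bar V]^T$, $\bar d=[d_1^T\bar W:\cdots:d_n^T\bar W]^T$. The coefficient vectors $\bar x=(\bar x_{ik})$, $\bar v=(\bar v_{ijk})$, $\bar w=(\bar w_{ij})$ are ordered compatibly (block $i=1,\dots,n$ first, and within a block in the order of the columns of $\bar X,\bar V,\bar W$). Semi-coarse MILP: minimize $a^Ty+\bar b^T\bar x+\bar c^T\bar v+\bar d^T\bar w$ over $(y,\bar x,\bar v,\bar w)$ subject to $Ay+\bar B\bar x+\bar C\bar v+\bar D\bar w\le f$, $y\in\{0,1\}^m$, and for all $i=1,\dots,n$: $\sum_{k=1}^K\bar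 x_{ik}\le1$, $\bar x_{ik}\in\{0,1\}$; $\sum_{k=1}^K\sum_{j=1}^{I_k}\bar v_{ijk}\le1$, $\sum_{j=1}^{I_k}\bar v_{ijk}=\bar x_{ik}$ for every $k$, $0\le\bar v_{ijk}\le1$; $\sum_{j=1}^J\bar w_{ij}\le1$, $0\le\bar w_{ij}\le1$. Reconstruction map. To $(y,\bar x,\bar v,\bar w)$ associate $(y,x,v,w)$ with blocks $x_i=\sum_{k}\bar x_{ik}\bar X_k$, $v_i=\sum_{k=1}^K\sum_{j=1}^{I_k}\bar v_{ijk}\bar V_{jk}$, $w_i=\sum_j\bar w_{ij}\bar W_j$. Terminology. $z^\star_{\rm MILP}$ and $z^\star_{\rm semi}$ are the optimal values (infima, $+\infty$ if infeasible) of the original and semi-coarse MILPs. "Tightening" means that the reconstruction map sends every feasible point of the semi-coarse MILP to a feasible point of the original MILP with the same objective value. "Equivalent" means that $z^\star_{\rm MILP}=z^\star_{\rm semi}$, that this value is attained in the semi-coarse MILP by a point that reconstructs to $(y^\star,x^\star,v^\star,w^\star)$, and that the reconstruction map sends optimal solutions of the semi-coarse MILP to optimal solutions of the original MILP. *)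

theory Defs
  imports "HOL-Library.Extended_Real" "Jordan_Normal_Form.Matrix"
begin

text \<open>All indices are 0-based: blocks, profiles and vector entries that are numbered
  \<open>1, \<dots>, n\<close> on paper are numbered \<open>0, \<dots>, n - 1\<close> here.  The order \<open>\<le>\<close> on \<open>real vec\<close> is
  componentwise and includes equality of the dimensions.\<close>

text \<open>A point \<open>(y, x, v, w)\<close> of the original problem or
  \<open>(y, xb, vb, wb)\<close> of the semi-coarse problem.\<close>

type_synonym point = "real vec \<times> real vec \<times> real vec \<times> real vec"

definition binary_vec :: "real vec \<Rightarrow> bool" where
  "binary_vec x \<longleftrightarrow> (\<forall>r < dim_vec x. x $ r \<in> {0, 1})"

definition opt_value :: "point set \<Rightarrow> (point \<Rightarrow> real) \<Rightarrow> ereal" where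
  "opt_value S g = (INF p\<in>S. ereal (g p))"

definition is_optimal :: "point set \<Rightarrow> (point \<Rightarrow> real) \<Rightarrow> point \<Rightarrow> bool" where
  "is_optimal S g p \<longleftrightarrow> p \<in> S \<and> (\<forall>q\<in>S. g p \<le> g q)"


section \<open>The original MILP\<close>

text \<open>The fields are, in this order,
  \<open>m, N, M, a, b, c, d, f, A, B, C, D, L, U\<close>.\<close>

record milp =
  dim_y :: nat
  dim_x :: nat
  num_rows :: nat
  cost_y :: "real vec"
  cost_x :: "real vec"
  cost_v :: "real vec"
  cost_w :: "real vec"
  rhs :: "real vec"
  mat_y :: "real mat"
  mat_x :: "real mat"
  mat_v :: "real mat"
  mat_w :: "real mat"
  lower :: real
  upper :: real

definition milp_wf :: "milp \<Rightarrow> bool" where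
  "milp_wf P \<longleftrightarrow>
     0 < dim_y P \<and> 0 < dim_x P \<and> 0 < num_rows P \<and>
     cost_y P \<in> carrier_vec (dim_y P) \<and>
     cost_x P \<in> carrier_vec (dim_x P) \<and>
     cost_v P \<in> carrier_vec (dim_x P) \<and>
     cost_w P \<in> carrier_vec (dim_x P) \<and>
     rhs P \<in> carrier_vec (num_rows P) \<and>
     mat_y P \<in> carrier_mat (num_rows P) (dim_y P) \<and>
     mat_x P \<in> carrier_mat (num_rows P) (dim_x P) \<and>
     mat_v P \<in> carrier_mat (num_rows P) (dim_x P) \<and>
     mat_w P \<in> carrier_mat (num_rows P) (dim_x P) \<and>
     lower P \<le> upper P"

definition milp_obj :: "milp \<Rightarrow> point \<Rightarrow> real" where
  "milp_obj P = (\<lambda>(y, x, v, w).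
     cost_y P \<bullet> y + cost_x P \<bullet> x + cost_v P \<bullet> v + cost_w P \<bullet> w)"

definition milp_feasible :: "milp \<Rightarrow> point set" where
  "milp_feasible P = {(y, x, v, w).
     y \<in> carrier_vec (dim_y P) \<and> x \<in> carrier_vec (dim_x P) \<and>
     v \<in> carrier_vec (dim_x P) \<and> w \<in> carrier_vec (dim_x P) \<and>
     mat_y P *\<^sub>v y + mat_x P *\<^sub>v x + mat_v P *\<^sub>v v + mat_w P *\<^sub>v w \<le> rhs P \<and>
     binary_vec y \<and> binary_vec x \<and>
     lower P \<cdot>\<^sub>v x \<le> v \<and> v \<le> upper P \<cdot>\<^sub>v x \<and>
     0\<^sub>v (dim_x P) \<le> w}"


section \<open>Blocks\<close>

definition vec_block :: "nat \<Rightarrow> nat \<Rightarrow> 'a vec \<Rightarrow> 'a vec" where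
  "vec_block s i x = vec s (\<lambda>r. x $ (i * s + r))"

definition col_block :: "nat \<Rightarrow> nat \<Rightarrow> 'a mat \<Rightarrow> 'a mat" where
  "col_block s i A = mat (dim_row A) s (\<lambda>(r, q). A $$ (r, i * s + q))"

text \<open>Concatenation of the blocks \<open>g 0, \<dots>, g (n - 1)\<close>, each of length (or width) \<open>s\<close>.\<close>

definition vec_concat :: "nat \<Rightarrow> nat \<Rightarrow> (nat \<Rightarrow> 'a vec) \<Rightarrow> 'a vec" where
  "vec_concat n s g = vec (n * s) (\<lambda>q. g (q div s) $ (q mod s))"

definition col_concat :: "nat \<Rightarrow> nat \<Rightarrow> nat \<Rightarrow> (nat \<Rightarrow> 'a mat) \<Rightarrow> 'a mat" where
  "col_concat nr n s G = mat nr (n * s) (\<lambda>(r, q). G (q div s) $$ (r, q mod s))"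


section \<open>Partition and profiles\<close>

text \<open>The fields are, in this order, \<open>n\<close>, \<open>\<delta>\<close>, \<open>K\<close>, \<open>X\<close>, \<open>I\<close>, \<open>V\<close>, \<open>J\<close>, \<open>W\<close>;
  \<open>prof_V Q j k\<close> is the profile with subscript \<open>jk\<close>, where \<open>j < num_V Q k\<close>.\<close>

record profiles =
  num_blocks :: nat
  block_len :: nat
  num_X :: nat
  prof_X :: "nat \<Rightarrow> real vec"
  num_V :: "nat \<Rightarrow> nat"
  prof_V :: "nat \<Rightarrow> nat \<Rightarrow> real vec"
  num_W :: nat
  prof_W :: "nat \<Rightarrow> real vec"

definition profiles_wf :: "milp \<Rightarrow> profiles \<Rightarrow> bool" where
  "profiles_wf P Q \<longleftrightarrow>
     0 < block_len Q \<and> dim_x P = num_blocks Q * block_len Q \<and>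
     (\<forall>k < num_X Q. prof_X Q k \<in> carrier_vec (block_len Q) \<and> binary_vec (prof_X Q k)) \<and>
     (\<forall>k < num_X Q. \<forall>j < num_V Q k.
        prof_V Q j k \<in> carrier_vec (block_len Q) \<and>
        lower P \<cdot>\<^sub>v prof_X Q k \<le> prof_V Q j k \<and> prof_V Q j k \<le> upper P \<cdot>\<^sub>v prof_X Q k) \<and>
     (\<forall>j < num_W Q. prof_W Q j \<in> carrier_vec (block_len Q) \<and>
        0\<^sub>v (block_len Q) \<le> prof_W Q j)"

definition X_mat :: "profiles \<Rightarrow> real mat" where
  "X_mat Q = mat_of_cols (block_len Q) (map (prof_X Q) [0..<num_X Q])"

definition V_mat :: "profiles \<Rightarrow> real mat" where
  "V_mat Q = mat_of_cols (block_len Q)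
     (concat (map (\<lambda>k. map (\<lambda>j. prof_V Q j k) [0..<num_V Q k]) [0..<num_X Q]))"

definition W_mat :: "profiles \<Rightarrow> real mat" where
  "W_mat Q = mat_of_cols (block_len Q) (map (prof_W Q) [0..<num_W Q])"

text \<open>Number of columns of \<open>V_mat\<close>, and the column at which the profiles for \<open>k\<close> start.\<close>

definition V_offset :: "profiles \<Rightarrow> nat \<Rightarrow> nat" where
  "V_offset Q k = (\<Sum>l<k. num_V Q l)"

definition total_V :: "profiles \<Rightarrow> nat" where
  "total_V Q = V_offset Q (num_X Q)"

text \<open>The entries of the coefficient vectors with subscripts \<open>ik\<close>, \<open>ijk\<close> and \<open>ij\<close>.\<close>

definition xb_coeff :: "profiles \<Rightarrow> real vec \<Rightarrow> nat \<Rightarrow> nat \<Rightarrow> real" where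
  "xb_coeff Q xb i k = xb $ (i * num_X Q + k)"

definition vb_coeff :: "profiles \<Rightarrow> real vec \<Rightarrow> nat \<Rightarrow> nat \<Rightarrow> nat \<Rightarrow> real" where
  "vb_coeff Q vb i j k = vb $ (i * total_V Q + (V_offset Q k + j))"

definition wb_coeff :: "profiles \<Rightarrow> real vec \<Rightarrow> nat \<Rightarrow> nat \<Rightarrow> real" where
  "wb_coeff Q wb i j = wb $ (i * num_W Q + j)"


section \<open>The semi-coarse MILP\<close>

text \<open>\<open>agg_mat Q A Z\<close> is \<open>[A\<^sub>1 Z : \<cdots> : A\<^sub>n Z]\<close> and \<open>agg_cost Q c Z\<close> is
  \<open>[c\<^sub>1\<^sup>T Z : \<cdots> : c\<^sub>n\<^sup>T Z]\<^sup>T\<close>, for \<open>Z\<close> one of the three profile matrices.\<close>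

definition agg_mat :: "profiles \<Rightarrow> real mat \<Rightarrow> real mat \<Rightarrow> real mat" where
  "agg_mat Q A Z = col_concat (dim_row A) (num_blocks Q) (dim_col Z)
     (\<lambda>i. col_block (block_len Q) i A * Z)"

definition agg_cost :: "profiles \<Rightarrow> real vec \<Rightarrow> real mat \<Rightarrow> real vec" where
  "agg_cost Q c Z = vec_concat (num_blocks Q) (dim_col Z)
     (\<lambda>i. transpose_mat Z *\<^sub>v vec_block (block_len Q) i c)"

definition semi_obj :: "milp \<Rightarrow> profiles \<Rightarrow> point \<Rightarrow> real" where
  "semi_obj P Q = (\<lambda>(y, xb, vb, wb).
     cost_y P \<bullet> y + agg_cost Q (cost_x P) (X_mat Q) \<bullet> xb
       + agg_cost Q (cost_v P) (V_mat Q) \<bullet> vb + agg_cost Q (cost_w P) (W_mat Q) \<bullet> wb)"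

definition semi_feasible :: "milp \<Rightarrow> profiles \<Rightarrow> point set" where
  "semi_feasible P Q = {(y, xb, vb, wb).
     y \<in> carrier_vec (dim_y P) \<and>
     xb \<in> carrier_vec (num_blocks Q * num_X Q) \<and>
     vb \<in> carrier_vec (num_blocks Q * total_V Q) \<and>
     wb \<in> carrier_vec (num_blocks Q * num_W Q) \<and>
     mat_y P *\<^sub>v y + agg_mat Q (mat_x P) (X_mat Q) *\<^sub>v xb
       + agg_mat Q (mat_v P) (V_mat Q) *\<^sub>v vb
       + agg_mat Q (mat_w P) (W_mat Q) *\<^sub>v wb \<le> rhs P \<and>
     binary_vec y \<and>
     (\<forall>i < num_blocks Q.
        (\<Sum>k<num_X Q. xb_coeff Q xb i k) \<le> 1 \<and>
        (\<forall>k < num_X Q. xb_coeff Q xb i k \<in> {0, 1}) \<and>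
        (\<Sum>k<num_X Q. \<Sum>j<num_V Q k. vb_coeff Q vb i j k) \<le> 1 \<and>
        (\<forall>k < num_X Q. (\<Sum>j<num_V Q k. vb_coeff Q vb i j k) = xb_coeff Q xb i k) \<and>
        (\<forall>k < num_X Q. \<forall>j < num_V Q k.
           0 \<le> vb_coeff Q vb i j k \<and> vb_coeff Q vb i j k \<le> 1) \<and>
        (\<Sum>j<num_W Q. wb_coeff Q wb i j) \<le> 1 \<and>
        (\<forall>j < num_W Q. 0 \<le> wb_coeff Q wb i j \<and> wb_coeff Q wb i j \<le> 1))}"


section \<open>Reconstruction, tightening and equivalence\<close>

definition recon :: "profiles \<Rightarrow> point \<Rightarrow> point" where
  "recon Q = (\<lambda>(y, xb, vb, wb).
     (let n = num_blocks Q; s = block_len Q in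
      (y,
       vec_concat n s (\<lambda>i. finsum_vec TYPE(real) s
         (\<lambda>k. xb_coeff Q xb i k \<cdot>\<^sub>v prof_X Q k) {..<num_X Q}),
       vec_concat n s (\<lambda>i. finsum_vec TYPE(real) s
         (\<lambda>k. finsum_vec TYPE(real) s
           (\<lambda>j. vb_coeff Q vb i j k \<cdot>\<^sub>v prof_V Q j k) {..<num_V Q k}) {..<num_X Q}),
       vec_concat n s (\<lambda>i. finsum_vec TYPE(real) s
         (\<lambda>j. wb_coeff Q wb i j \<cdot>\<^sub>v prof_W Q j) {..<num_W Q}))))"

definition tightening :: "milp \<Rightarrow> profiles \<Rightarrow> bool" where
  "tightening P Q \<longleftrightarrow> (\<forall>p \<in> semi_feasible P Q.
     recon Q p \<in> milp_feasible P \<and> milp_obj P (recon Q p) = semi_obj P Q p)"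

definition z_milp :: "milp \<Rightarrow> ereal" where
  "z_milp P = opt_value (milp_feasible P) (milp_obj P)"

definition z_semi :: "milp \<Rightarrow> profiles \<Rightarrow> ereal" where
  "z_semi P Q = opt_value (semi_feasible P Q) (semi_obj P Q)"

definition milp_optimal :: "milp \<Rightarrow> point \<Rightarrow> bool" where
  "milp_optimal P = is_optimal (milp_feasible P) (milp_obj P)"

definition semi_optimal :: "milp \<Rightarrow> profiles \<Rightarrow> point \<Rightarrow> bool" where
  "semi_optimal P Q = is_optimal (semi_feasible P Q) (semi_obj P Q)"

text \<open>Equivalence is relative to the point that is to be reconstructed.\<close>

definition equivalent_at :: "milp \<Rightarrow> profiles \<Rightarrow> point \<Rightarrow> bool" where
  "equivalent_at P Q star \<longleftrightarrow>
     z_milp P = z_semi P Q \<and>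
     (\<exists>p \<in> semi_feasible P Q. ereal (semi_obj P Q p) = z_semi P Q \<and> recon Q p = star) \<and>
     (\<forall>p. semi_optimal P Q p \<longrightarrow> milp_optimal P (recon Q p))"

definition profiles_include :: "profiles \<Rightarrow> point \<Rightarrow> bool" where
  "profiles_include Q = (\<lambda>(y, x, v, w). \<forall>i < num_blocks Q.
     (\<exists>k < num_X Q. \<exists>j < num_V Q k.
        prof_X Q k = vec_block (block_len Q) i x \<and>
        prof_V Q j k = vec_block (block_len Q) i v) \<and>
     (\<exists>j < num_W Q. prof_W Q j = vec_block (block_len Q) i w))"

end

theory Submission
  imports Defs
begin

text \<open>
  For a profile matrix \<open>Z\<close>, let \<open>diag(Z, \<dots>, Z)\<close> be the block diagonal matrix with one copy of \<open>Z\<close>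
  per block.  The reconstruction map is linear: it leaves \<open>y\<close> alone and applies
  \<open>diag(X, \<dots>, X)\<close>, \<open>diag(V, \<dots>, V)\<close> and \<open>diag(W, \<dots>, W)\<close> to the three coefficient vectors, where
  \<open>X\<close>, \<open>V\<close>, \<open>W\<close> have the profiles as their columns (\<open>recon_eq_blockwise_mult\<close>).  Aggregating the
  data multiplies cost rows and constraint matrices by the same block diagonal matrices on the
  right.  Hence a semi-coarse point and its reconstruction have the same objective value and
  the same left-hand side in the linear constraints (\<open>agg_cost_scalar_prod\<close>, \<open>agg_mat_mult_vec\<close>).

  What remains for the tightening is that the reconstructed blocks obey the sign, bound and
  integrality restrictions (\<open>semi_feasible_recon\<close>).  A block of \<open>x\<close> is zero or a single binary
  profile; a block of \<open>w\<close> is a nonnegative combination of nonnegative profiles; and the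
  bounds on \<open>v\<close> are nonnegative combinations of the bounds on the \<open>V\<close>-profiles, since the
  \<open>V\<close>-coefficients of profile \<open>k\<close> add up to the coefficient of the \<open>k\<close>-th \<open>X\<close>-profile.
  The inequality between the optimal values follows at once.

  For the equivalence, a feasible point all of whose blocks are profiles is the reconstruction of
  the semi-coarse point whose coefficients select exactly these profiles
  (\<open>profiles_include_lift\<close>).  If the point is optimal, the semi-coarse problem attains the
  optimal value of the original problem, and every semi-coarse optimum reconstructs to a feasible
  point with this value (\<open>equivalent_at_lift\<close>).
\<close>

section \<open>Optimal values\<close>

lemma opt_value_is_optimal:
  assumes "is_optimal S g p"
  shows "opt_value S g = ereal (g p)"
  unfolding opt_value_def
proof (rule antisym)
  show "(INF q\<in>S. ereal (g q)) \<le> ereal (g p)"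
    using assms by (intro INF_lower) (simp add: is_optimal_def)
  show "ereal (g p) \<le> (INF q\<in>S. ereal (g q))"
    using assms by (intro INF_greatest) (simp add: is_optimal_def)
qed


section \<open>Sums and vectors split into blocks\<close>

lemma sum_lessThan_add:
  fixes f :: "nat \<Rightarrow> 'a::comm_monoid_add"
  shows "(\<Sum>t<a + b. f t) = (\<Sum>t<a. f t) + (\<Sum>j<b. f (a + j))"
  by (induction b) (simp_all add: add.assoc)

lemma sum_lessThan_blocks:
  fixes f :: "nat \<Rightarrow> 'a::comm_monoid_add"
  shows "(\<Sum>q<n * s. f q) = (\<Sum>i<n. \<Sum>r<s. f (i * s + r))"
proof (induction n)
  case (Suc n)
  have "Suc n * s = n * s + s" by simp
  then show ?case by (simp only: sum_lessThan_add Suc sum.lessThan_Suc)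
qed simp

text \<open>A sum of zeros and ones is a natural number, and 0 and 1 are the only ones up to 1.\<close>

lemma sum_binary:
  fixes g :: "nat \<Rightarrow> real"
  assumes "\<And>k. k < N \<Longrightarrow> g k \<in> {0, 1}" and "(\<Sum>k<N. g k) \<le> 1"
  shows "(\<Sum>k<N. g k) \<in> {0, 1}"
proof -
  define t :: nat where "t = (\<Sum>k<N. if g k = 1 then 1 else 0)"
  have t: "(\<Sum>k<N. g k) = real t"
    unfolding t_def of_nat_sum using assms(1) by (intro sum.cong) auto
  with assms(2) have "t \<le> 1" by simp
  then show ?thesis using t by (cases t) auto
qed

lemma block_index_less:
  fixes i n r s :: nat
  assumes "i < n" and "r < s"
  shows "i * s + r < n * s"
proof -
  have "i * s + r < Suc i * s" using assms(2) by simp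
  also have "\<dots> \<le> n * s" using assms(1) by (intro mult_right_mono) auto
  finally show ?thesis .
qed

lemma block_div_mod:
  fixes n q s :: nat
  assumes "q < n * s"
  shows "q div s < n" and "q mod s < s"
proof -
  have "0 < s" using assms by (cases s) auto
  then show "q mod s < s" by simp
  show "q div s < n" using assms by (simp add: less_mult_imp_div_less)
qed

lemma vec_block_carrier [simp]: "vec_block s i x \<in> carrier_vec s"
  by (simp add: vec_block_def)

lemma vec_concat_carrier [simp]: "vec_concat n s g \<in> carrier_vec (n * s)"
  by (simp add: vec_concat_def)

lemma vec_block_vec_concat:
  assumes "i < n" and "g i \<in> carrier_vec s"
  shows "vec_block s i (vec_concat n s g) = g i"
  using assms by (intro eq_vecI) (auto simp: vec_block_def vec_concat_def block_index_less)

lemma vec_concat_vec_block: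
  assumes "x \<in> carrier_vec (n * s)"
  shows "vec_concat n s (\<lambda>i. vec_block s i x) = x"
  using assms by (intro eq_vecI) (auto simp: vec_block_def vec_concat_def block_div_mod)

lemma vec_concat_cong:
  assumes "\<And>i. i < n \<Longrightarrow> g i = h i"
  shows "vec_concat n s g = vec_concat n s h"
  using assms by (intro eq_vecI) (auto simp: vec_concat_def block_div_mod)

lemma scalar_prod_vec_concat:
  fixes x :: "'a::comm_semiring_0 vec"
  assumes x: "x \<in> carrier_vec (n * s)" and g: "\<And>i. i < n \<Longrightarrow> g i \<in> carrier_vec s"
  shows "x \<bullet> vec_concat n s g = (\<Sum>i<n. vec_block s i x \<bullet> g i)"
proof -
  have "x \<bullet> vec_concat n s g = (\<Sum>q<n * s. x $ q * g (q div s) $ (q mod s))"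
    by (simp add: scalar_prod_def vec_concat_def atLeast0LessThan)
  also have "\<dots> = (\<Sum>i<n. \<Sum>r<s. x $ (i * s + r) * g i $ r)"
    unfolding sum_lessThan_blocks by (intro sum.cong) auto
  also have "\<dots> = (\<Sum>i<n. vec_block s i x \<bullet> g i)"
  proof (intro sum.cong refl)
    fix i assume "i \<in> {..<n}"
    then have "dim_vec (g i) = s" using g[of i] by simp
    then show "(\<Sum>r<s. x $ (i * s + r) * g i $ r) = vec_block s i x \<bullet> g i"
      by (simp add: scalar_prod_def vec_block_def atLeast0LessThan)
  qed
  finally show ?thesis .
qed


section \<open>Aggregation is adjoint to blockwise reconstruction\<close>

text \<open>This is the product of \<open>z\<close> with the block diagonal matrix \<open>diag(Z, \<dots>, Z)\<close>.\<close>

definition blockwise_mult :: "profiles \<Rightarrow> real mat \<Rightarrow> real vec \<Rightarrow> real vec" where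
  "blockwise_mult Q Z z = vec_concat (num_blocks Q) (block_len Q)
     (\<lambda>i. Z *\<^sub>v vec_block (dim_col Z) i z)"

lemma blockwise_mult_carrier [simp]:
  "blockwise_mult Q Z z \<in> carrier_vec (num_blocks Q * block_len Q)"
  by (simp add: blockwise_mult_def)

lemma dim_blockwise_mult [simp]:
  "dim_vec (blockwise_mult Q Z z) = num_blocks Q * block_len Q"
  using carrier_vecD[OF blockwise_mult_carrier] .

text \<open>Blockwise, this is the adjointness \<open>(Z\<^sup>T c\<^sub>i) \<bullet> z\<^sub>i = c\<^sub>i \<bullet> (Z z\<^sub>i)\<close>.  It makes the objective
  values of a semi-coarse point and of its reconstruction equal.\<close>

lemma agg_cost_scalar_prod:
  assumes Z: "dim_row Z = block_len Q"
    and c: "c \<in> carrier_vec (num_blocks Q * block_len Q)"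
    and z: "z \<in> carrier_vec (num_blocks Q * dim_col Z)"
  shows "agg_cost Q c Z \<bullet> z = c \<bullet> blockwise_mult Q Z z"
proof -
  let ?n = "num_blocks Q" and ?s = "block_len Q" and ?t = "dim_col Z"
  have "agg_cost Q c Z \<bullet> z = z \<bullet> agg_cost Q c Z"
    using z by (intro comm_scalar_prod) (simp_all add: agg_cost_def)
  also have "\<dots> = (\<Sum>i<?n. vec_block ?t i z \<bullet> (transpose_mat Z *\<^sub>v vec_block ?s i c))"
    unfolding agg_cost_def using z by (intro scalar_prod_vec_concat) (auto intro: carrier_vecI)
  also have "\<dots> = (\<Sum>i<?n. vec_block ?s i c \<bullet> (Z *\<^sub>v vec_block ?t i z))"
  proof (intro sum.cong refl)
    fix i
    have Zc: "Z \<in> carrier_mat ?s ?t" using Z by auto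
    have "vec_block ?t i z \<bullet> (transpose_mat Z *\<^sub>v vec_block ?s i c)
        = (transpose_mat Z *\<^sub>v vec_block ?s i c) \<bullet> vec_block ?t i z"
      by (rule comm_scalar_prod[of _ ?t]) (auto intro: carrier_vecI)
    also have "\<dots> = vec_block ?s i c \<bullet> (Z *\<^sub>v vec_block ?t i z)"
      by (rule transpose_vec_mult_scalar[OF Zc]) simp_all
    finally show "vec_block ?t i z \<bullet> (transpose_mat Z *\<^sub>v vec_block ?s i c)
        = vec_block ?s i c \<bullet> (Z *\<^sub>v vec_block ?t i z)" .
  qed
  also have "\<dots> = c \<bullet> blockwise_mult Q Z z"
    unfolding blockwise_mult_def using Z c
    by (intro scalar_prod_vec_concat[symmetric]) (auto intro: carrier_vecI)
  finally show ?thesis .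
qed

text \<open>A matrix is aggregated row by row in the way a cost vector is, so the statement about
  constraints reduces to the one about costs.\<close>

lemma row_agg_mat:
  assumes Z: "dim_row Z = block_len Q" and A: "A \<in> carrier_mat nr (num_blocks Q * block_len Q)"
    and r: "r < nr"
  shows "row (agg_mat Q A Z) r = agg_cost Q (row A r) Z"
proof (rule eq_vecI)
  let ?n = "num_blocks Q" and ?s = "block_len Q" and ?t = "dim_col Z"
  show "dim_vec (row (agg_mat Q A Z) r) = dim_vec (agg_cost Q (row A r) Z)"
    by (simp add: agg_mat_def agg_cost_def col_concat_def vec_concat_def)
  fix q assume "q < dim_vec (agg_cost Q (row A r) Z)"
  then have q: "q < ?n * ?t" by (simp add: agg_cost_def vec_concat_def)
  define i where "i = q div ?t"
  define p where "p = q mod ?t"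
  have ip: "i < ?n" "p < ?t" unfolding i_def p_def using block_div_mod[OF q] by auto
  have row: "row (col_block ?s i A) r = vec_block ?s i (row A r)"
    using A r ip by (intro eq_vecI) (auto simp: col_block_def vec_block_def block_index_less)
  have "row (agg_mat Q A Z) r $ q = row (col_block ?s i A) r \<bullet> col Z p"
    using A r q ip by (simp add: agg_mat_def col_concat_def i_def[symmetric] p_def[symmetric] col_block_def)
  also have "\<dots> = col Z p \<bullet> vec_block ?s i (row A r)"
    unfolding row using Z by (intro comm_scalar_prod[of _ ?s]) (auto intro: carrier_vecI)
  also have "\<dots> = agg_cost Q (row A r) Z $ q"
    using q ip by (simp add: agg_cost_def vec_concat_def i_def[symmetric] p_def[symmetric])
  finally show "row (agg_mat Q A Z) r $ q = agg_cost Q (row A r) Z $ q" .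
qed

lemma agg_mat_mult_vec:
  assumes Z: "dim_row Z = block_len Q" and A: "A \<in> carrier_mat nr (num_blocks Q * block_len Q)"
    and z: "z \<in> carrier_vec (num_blocks Q * dim_col Z)"
  shows "agg_mat Q A Z *\<^sub>v z = A *\<^sub>v blockwise_mult Q Z z"
proof (rule eq_vecI)
  have nr: "dim_row A = nr" and nr': "dim_row (agg_mat Q A Z) = nr"
    using A by (auto simp: agg_mat_def col_concat_def)
  then show "dim_vec (agg_mat Q A Z *\<^sub>v z) = dim_vec (A *\<^sub>v blockwise_mult Q Z z)" by simp
  fix r assume "r < dim_vec (A *\<^sub>v blockwise_mult Q Z z)"
  then have r: "r < nr" using nr by simp
  have "row A r \<in> carrier_vec (num_blocks Q * block_len Q)"
    using A by (auto intro: carrier_vecI)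
  from agg_cost_scalar_prod[OF Z this z]
  show "(agg_mat Q A Z *\<^sub>v z) $ r = (A *\<^sub>v blockwise_mult Q Z z) $ r"
    using r nr nr' by (simp add: row_agg_mat[OF Z A r])
qed


section \<open>Columns of the profile matrices\<close>

lemma X_mat_dim [simp]: "dim_row (X_mat Q) = block_len Q" "dim_col (X_mat Q) = num_X Q"
  by (simp_all add: X_mat_def)

lemma W_mat_dim [simp]: "dim_row (W_mat Q) = block_len Q" "dim_col (W_mat Q) = num_W Q"
  by (simp_all add: W_mat_def)

lemma length_concat_upt:
  "length (concat (map (\<lambda>k. map (f k) [0..<h k]) [0..<K])) = (\<Sum>k<K. h k)"
  by (induction K) simp_all

lemma V_mat_dim [simp]: "dim_row (V_mat Q) = block_len Q" "dim_col (V_mat Q) = total_V Q"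
  by (simp_all add: V_mat_def total_V_def V_offset_def length_concat_upt)

lemma V_offset_add_less:
  assumes "k < K" and "j < num_V Q k"
  shows "V_offset Q k + j < V_offset Q K"
proof -
  have "V_offset Q k + j < V_offset Q (Suc k)" using assms(2) by (simp add: V_offset_def)
  also have "\<dots> \<le> V_offset Q K"
    unfolding V_offset_def using assms(1) by (intro sum_mono2) auto
  finally show ?thesis .
qed

text \<open>Distinct pairs of subscripts \<open>j, k\<close> occupy distinct columns, because the columns that
  belong to \<open>k\<close> end before those of any larger \<open>k'\<close> begin.\<close>

lemma V_offset_add_inject:
  assumes "j < num_V Q k" and "j' < num_V Q k'"
  shows "V_offset Q k + j = V_offset Q k' + j' \<longleftrightarrow> k = k' \<and> j = j'"
  using V_offset_add_less[of k k' j Q] V_offset_add_less[of k' k j' Q] assms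
  by (cases k k' rule: linorder_cases) auto

text \<open>This turns a sum over the columns of \<open>V_mat\<close> into the double sum that the constraints and
  the reconstruction map use.\<close>

lemma sum_lessThan_V_offset:
  fixes f :: "nat \<Rightarrow> 'a::comm_monoid_add"
  shows "(\<Sum>t<V_offset Q K. f t) = (\<Sum>k<K. \<Sum>j<num_V Q k. f (V_offset Q k + j))"
proof (induction K)
  case (Suc K)
  have "V_offset Q (Suc K) = V_offset Q K + num_V Q K" by (simp add: V_offset_def)
  then show ?case by (simp add: sum_lessThan_add Suc)
qed (simp add: V_offset_def)

lemma nth_concat_upt:
  assumes "k < K" and "j < h k"
  shows "concat (map (\<lambda>k. map (f k) [0..<h k]) [0..<K]) ! ((\<Sum>l<k. h l) + j) = f k j"
  using assms(1)
proof (induction K)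
  case (Suc K)
  let ?xs = "concat (map (\<lambda>k. map (f k) [0..<h k]) [0..<K])"
  show ?case
  proof (cases "k = K")
    case True
    then show ?thesis using assms(2) by (simp add: nth_append length_concat_upt)
  next
    case False
    with Suc.prems have k: "k < K" by simp
    have "(\<Sum>l<k. h l) + j < (\<Sum>l<Suc k. h l)" using assms(2) by simp
    also have "\<dots> \<le> (\<Sum>l<K. h l)" using k by (intro sum_mono2) auto
    finally have "(\<Sum>l<k. h l) + j < length ?xs" by (simp only: length_concat_upt)
    then show ?thesis using Suc.IH[OF k] by (simp add: nth_append)
  qed
qed simp

lemma col_X_mat:
  assumes "k < num_X Q" and "prof_X Q k \<in> carrier_vec (block_len Q)"
  shows "col (X_mat Q) k = prof_X Q k"
  using assms by (simp add: X_mat_def)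

lemma col_W_mat:
  assumes "j < num_W Q" and "prof_W Q j \<in> carrier_vec (block_len Q)"
  shows "col (W_mat Q) j = prof_W Q j"
  using assms by (simp add: W_mat_def)

lemma col_V_mat:
  assumes k: "k < num_X Q" and j: "j < num_V Q k" and c: "prof_V Q j k \<in> carrier_vec (block_len Q)"
  shows "col (V_mat Q) (V_offset Q k + j) = prof_V Q j k"
proof -
  let ?xs = "concat (map (\<lambda>k. map (\<lambda>j. prof_V Q j k) [0..<num_V Q k]) [0..<num_X Q])"
  have nth: "?xs ! (V_offset Q k + j) = prof_V Q j k"
    unfolding V_offset_def
    by (rule nth_concat_upt[where h = "num_V Q" and f = "\<lambda>k j. prof_V Q j k", OF k j])
  have "V_offset Q k + j < length ?xs"
    using V_offset_add_less[OF k j] by (simp only: length_concat_upt V_offset_def)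
  then show ?thesis
    unfolding V_mat_def using nth c by (simp only: col_mat_of_cols)
qed

lemma mat_mult_vec_unit_vec:
  fixes Z :: "'a::semiring_1 mat"
  assumes "t < dim_col Z"
  shows "Z *\<^sub>v unit_vec (dim_col Z) t = col Z t"
  using assms by (intro eq_vecI) auto


section \<open>Reconstruction in coordinates\<close>

lemma finsum_vec_eqI:
  fixes v :: "'a::comm_monoid_add vec"
  assumes F: "finite F" and f: "\<And>k. k \<in> F \<Longrightarrow> f k \<in> carrier_vec N" and v: "v \<in> carrier_vec N"
    and eq: "\<And>r. r < N \<Longrightarrow> (\<Sum>k\<in>F. f k $ r) = v $ r"
  shows "finsum_vec TYPE('a) N f F = v"
proof (rule eq_vecI)
  have f': "f \<in> F \<rightarrow> carrier_vec N" using f by simp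
  then have "finsum_vec TYPE('a) N f F \<in> carrier_vec N" by (rule finsum_vec_closed)
  then show "dim_vec (finsum_vec TYPE('a) N f F) = dim_vec v" using v by simp
  fix r assume "r < dim_vec v"
  then have r: "r < N" using v by simp
  show "finsum_vec TYPE('a) N f F $ r = v $ r"
    unfolding index_finsum_vec[OF F r f'] by (rule eq[OF r])
qed

lemma mat_mult_vec_block_index:
  fixes Z :: "real mat"
  assumes "r < dim_row Z"
  shows "(Z *\<^sub>v vec_block (dim_col Z) i z) $ r = (\<Sum>t<dim_col Z. z $ (i * dim_col Z + t) * col Z t $ r)"
  using assms by (simp add: scalar_prod_def vec_block_def atLeast0LessThan mult.commute)

locale profile_system =
  fixes P :: milp and Q :: profiles
  assumes wf: "milp_wf P" and profiles_wf: "profiles_wf P Q"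
begin

abbreviation "n \<equiv> num_blocks Q"
abbreviation "s \<equiv> block_len Q"

lemma dim_x_eq: "dim_x P = n * s"
  using profiles_wf by (simp add: profiles_wf_def)

lemma prof_carrier:
  "k < num_X Q \<Longrightarrow> prof_X Q k \<in> carrier_vec s"
  "k < num_X Q \<Longrightarrow> j < num_V Q k \<Longrightarrow> prof_V Q j k \<in> carrier_vec s"
  "l < num_W Q \<Longrightarrow> prof_W Q l \<in> carrier_vec s"
  using profiles_wf by (simp_all add: profiles_wf_def)

lemma prof_dim:
  "k < num_X Q \<Longrightarrow> dim_vec (prof_X Q k) = s"
  "k < num_X Q \<Longrightarrow> j < num_V Q k \<Longrightarrow> dim_vec (prof_V Q j k) = s"
  "l < num_W Q \<Longrightarrow> dim_vec (prof_W Q l) = s"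
  using prof_carrier[THEN carrier_vecD] by auto

lemma X_block_index:
  assumes "r < s"
  shows "(X_mat Q *\<^sub>v vec_block (num_X Q) i xb) $ r = (\<Sum>k<num_X Q. xb_coeff Q xb i k * prof_X Q k $ r)"
  using mat_mult_vec_block_index[of r "X_mat Q" i xb] assms
  by (simp add: xb_coeff_def col_X_mat prof_carrier del: index_mult_mat_vec)

lemma W_block_index:
  assumes "r < s"
  shows "(W_mat Q *\<^sub>v vec_block (num_W Q) i wb) $ r = (\<Sum>j<num_W Q. wb_coeff Q wb i j * prof_W Q j $ r)"
  using mat_mult_vec_block_index[of r "W_mat Q" i wb] assms
  by (simp add: wb_coeff_def col_W_mat prof_carrier del: index_mult_mat_vec)

lemma V_block_index:
  assumes "r < s"
  shows "(V_mat Q *\<^sub>v vec_block (total_V Q) i vb) $ r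
       = (\<Sum>k<num_X Q. \<Sum>j<num_V Q k. vb_coeff Q vb i j k * prof_V Q j k $ r)"
proof -
  have "(V_mat Q *\<^sub>v vec_block (total_V Q) i vb) $ r
      = (\<Sum>t<V_offset Q (num_X Q). vb $ (i * total_V Q + t) * col (V_mat Q) t $ r)"
    using mat_mult_vec_block_index[of r "V_mat Q" i vb] assms
    by (simp add: total_V_def del: index_mult_mat_vec)
  also have "\<dots> = (\<Sum>k<num_X Q. \<Sum>j<num_V Q k. vb_coeff Q vb i j k * prof_V Q j k $ r)"
    unfolding sum_lessThan_V_offset
    by (intro sum.cong refl) (simp add: col_V_mat prof_carrier vb_coeff_def)
  finally show ?thesis .
qed

text \<open>Every reconstructed block is a linear combination of profiles, that is, the product of the
  profile matrix with the corresponding block of coefficients.\<close>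

lemma recon_eq_blockwise_mult:
  "recon Q (y, xb, vb, wb)
   = (y, blockwise_mult Q (X_mat Q) xb, blockwise_mult Q (V_mat Q) vb, blockwise_mult Q (W_mat Q) wb)"
proof -
  have X: "finsum_vec TYPE(real) s (\<lambda>k. xb_coeff Q xb i k \<cdot>\<^sub>v prof_X Q k) {..<num_X Q}
      = X_mat Q *\<^sub>v vec_block (num_X Q) i xb" for i
    by (intro finsum_vec_eqI)
      (auto simp: X_block_index prof_carrier prof_dim intro: carrier_vecI simp del: index_mult_mat_vec)
  have W: "finsum_vec TYPE(real) s (\<lambda>j. wb_coeff Q wb i j \<cdot>\<^sub>v prof_W Q j) {..<num_W Q}
      = W_mat Q *\<^sub>v vec_block (num_W Q) i wb" for i
    by (intro finsum_vec_eqI)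
      (auto simp: W_block_index prof_carrier prof_dim intro: carrier_vecI simp del: index_mult_mat_vec)
  have inner: "finsum_vec TYPE(real) s (\<lambda>j. vb_coeff Q vb i j k \<cdot>\<^sub>v prof_V Q j k) {..<num_V Q k}
      = vec s (\<lambda>r. \<Sum>j<num_V Q k. vb_coeff Q vb i j k * prof_V Q j k $ r)"
    if "k < num_X Q" for i k
    using that by (intro finsum_vec_eqI) (auto simp: prof_carrier prof_dim)
  have V: "finsum_vec TYPE(real) s (\<lambda>k. finsum_vec TYPE(real) s
        (\<lambda>j. vb_coeff Q vb i j k \<cdot>\<^sub>v prof_V Q j k) {..<num_V Q k}) {..<num_X Q}
      = V_mat Q *\<^sub>v vec_block (total_V Q) i vb" for i
    by (intro finsum_vec_eqI)
      (auto simp: V_block_index inner intro: carrier_vecI simp del: index_mult_mat_vec)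
  show ?thesis
    by (simp add: recon_def Let_def blockwise_mult_def X V W)
qed


section \<open>Tightening\<close>

lemma mat_wf:
  "mat_x P \<in> carrier_mat (num_rows P) (n * s)"
  "mat_v P \<in> carrier_mat (num_rows P) (n * s)"
  "mat_w P \<in> carrier_mat (num_rows P) (n * s)"
  "cost_x P \<in> carrier_vec (n * s)"
  "cost_v P \<in> carrier_vec (n * s)"
  "cost_w P \<in> carrier_vec (n * s)"
  using wf dim_x_eq by (simp_all add: milp_wf_def)

lemma milp_obj_recon:
  assumes "xb \<in> carrier_vec (n * num_X Q)" and "vb \<in> carrier_vec (n * total_V Q)"
    and "wb \<in> carrier_vec (n * num_W Q)"
  shows "milp_obj P (recon Q (y, xb, vb, wb)) = semi_obj P Q (y, xb, vb, wb)"
  using assms by (simp add: recon_eq_blockwise_mult milp_obj_def semi_obj_def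
      agg_cost_scalar_prod mat_wf)

lemma constraint_lhs_recon:
  assumes "xb \<in> carrier_vec (n * num_X Q)" and "vb \<in> carrier_vec (n * total_V Q)"
    and "wb \<in> carrier_vec (n * num_W Q)"
  shows "mat_y P *\<^sub>v y + agg_mat Q (mat_x P) (X_mat Q) *\<^sub>v xb
       + agg_mat Q (mat_v P) (V_mat Q) *\<^sub>v vb + agg_mat Q (mat_w P) (W_mat Q) *\<^sub>v wb
     = mat_y P *\<^sub>v y + mat_x P *\<^sub>v blockwise_mult Q (X_mat Q) xb
       + mat_v P *\<^sub>v blockwise_mult Q (V_mat Q) vb + mat_w P *\<^sub>v blockwise_mult Q (W_mat Q) wb"
  using assms agg_mat_mult_vec[OF X_mat_dim(1) mat_wf(1), of xb]
    agg_mat_mult_vec[OF V_mat_dim(1) mat_wf(2), of vb]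
    agg_mat_mult_vec[OF W_mat_dim(1) mat_wf(3), of wb]
  by simp

lemma blockwise_mult_index:
  assumes "dim_row Z = s" and "q < n * s"
  shows "blockwise_mult Q Z z $ q = (Z *\<^sub>v vec_block (dim_col Z) (q div s) z) $ (q mod s)"
  using assms by (simp add: blockwise_mult_def vec_concat_def)

lemma prof_X_binary:
  assumes "k < num_X Q" and "r < s"
  shows "prof_X Q k $ r \<in> {0, 1}"
proof -
  have "binary_vec (prof_X Q k)"
    using profiles_wf assms(1) by (simp add: profiles_wf_def)
  then show ?thesis
    using assms by (simp add: binary_vec_def prof_dim)
qed

lemma prof_V_bounds:
  assumes "k < num_X Q" and "j < num_V Q k" and "r < s"
  shows "lower P * prof_X Q k $ r \<le> prof_V Q j k $ r" and "prof_V Q j k $ r \<le> upper P * prof_X Q k $ r"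
proof -
  have "dim_vec (prof_X Q k) = s" "dim_vec (prof_V Q j k) = s"
    using assms by (simp_all add: prof_dim)
  moreover have "lower P \<cdot>\<^sub>v prof_X Q k \<le> prof_V Q j k" "prof_V Q j k \<le> upper P \<cdot>\<^sub>v prof_X Q k"
    using profiles_wf assms by (simp_all add: profiles_wf_def)
  ultimately show "lower P * prof_X Q k $ r \<le> prof_V Q j k $ r"
    and "prof_V Q j k $ r \<le> upper P * prof_X Q k $ r"
    using assms(3) by (simp_all add: less_eq_vec_def)
qed

lemma prof_W_nonneg:
  assumes "j < num_W Q" and "r < s"
  shows "0 \<le> prof_W Q j $ r"
proof -
  have "0\<^sub>v s \<le> prof_W Q j"
    using profiles_wf assms(1) by (simp add: profiles_wf_def)
  then show ?thesis
    using assms by (simp add: less_eq_vec_def prof_dim)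
qed

text \<open>The bounds on \<open>v\<close> are the delicate part: \<open>x\<close> and \<open>v\<close> are combinations with different
  coefficients.  The link \<open>\<Sum>\<^sub>j vb\<^sub>i\<^sub>j\<^sub>k = xb\<^sub>i\<^sub>k\<close> rewrites \<open>x\<close> as a combination with the coefficients
  of \<open>v\<close>, and then the bounds hold term by term.\<close>

lemma semi_feasible_recon:
  assumes p: "(y, xb, vb, wb) \<in> semi_feasible P Q"
  shows "recon Q (y, xb, vb, wb) \<in> milp_feasible P"
proof -
  let ?x = "blockwise_mult Q (X_mat Q) xb"
  let ?v = "blockwise_mult Q (V_mat Q) vb"
  let ?w = "blockwise_mult Q (W_mat Q) wb"
  have carr: "xb \<in> carrier_vec (n * num_X Q)" "vb \<in> carrier_vec (n * total_V Q)"
    "wb \<in> carrier_vec (n * num_W Q)"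
    using p by (simp_all add: semi_feasible_def)
  have rows: "mat_y P *\<^sub>v y + mat_x P *\<^sub>v ?x + mat_v P *\<^sub>v ?v + mat_w P *\<^sub>v ?w \<le> rhs P"
    using p constraint_lhs_recon[OF carr, of y] by (simp add: semi_feasible_def)
  have x_index: "?x $ q = (\<Sum>k<num_X Q. xb_coeff Q xb (q div s) k * prof_X Q k $ (q mod s))"
    and v_index: "?v $ q = (\<Sum>k<num_X Q. \<Sum>j<num_V Q k.
        vb_coeff Q vb (q div s) j k * prof_V Q j k $ (q mod s))"
    and w_index: "?w $ q = (\<Sum>j<num_W Q. wb_coeff Q wb (q div s) j * prof_W Q j $ (q mod s))"
    if "q < n * s" for q
    using that block_div_mod[OF that]
    by (simp_all add: blockwise_mult_index X_block_index V_block_index W_block_index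
        del: index_mult_mat_vec)
  have xb01: "xb_coeff Q xb i k \<in> {0, 1}"
    and xb_sum: "(\<Sum>k<num_X Q. xb_coeff Q xb i k) \<le> 1"
    and vb_sum: "(\<Sum>j<num_V Q k. vb_coeff Q vb i j k) = xb_coeff Q xb i k"
    if "i < n" "k < num_X Q" for i k
    using p that by (simp_all add: semi_feasible_def)
  have vb0: "0 \<le> vb_coeff Q vb i j k" if "i < n" "k < num_X Q" "j < num_V Q k" for i j k
    using p that by (simp add: semi_feasible_def)
  have wb0: "0 \<le> wb_coeff Q wb i j" if "i < n" "j < num_W Q" for i j
    using p that by (simp add: semi_feasible_def)
  \<comment> \<open>Each entry is a sum of zeros and ones, bounded by the sum of the coefficients.\<close>
  have bin: "?x $ q \<in> {0, 1}" if q: "q < n * s" for q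
  proof -
    note dm = block_div_mod[OF q]
    have le: "xb_coeff Q xb (q div s) k * prof_X Q k $ (q mod s) \<le> xb_coeff Q xb (q div s) k"
      and mem: "xb_coeff Q xb (q div s) k * prof_X Q k $ (q mod s) \<in> {0, 1}"
      if "k < num_X Q" for k
      using xb01[OF dm(1) that] prof_X_binary[OF that dm(2)] by auto
    have "(\<Sum>k<num_X Q. xb_coeff Q xb (q div s) k * prof_X Q k $ (q mod s))
        \<le> (\<Sum>k<num_X Q. xb_coeff Q xb (q div s) k)"
      by (intro sum_mono) (simp add: le)
    \<comment> \<open>Without \<open>X\<close>-profiles the sum is empty; otherwise \<open>xb_sum\<close> applies.\<close>
    also have "\<dots> \<le> 1"
      using xb_sum[OF dm(1)] by (cases "num_X Q = 0") auto
    finally show ?thesis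
      unfolding x_index[OF q] by (intro sum_binary mem)
  qed
  have scale: "c * ?x $ q = (\<Sum>k<num_X Q. \<Sum>j<num_V Q k.
      vb_coeff Q vb (q div s) j k * (c * prof_X Q k $ (q mod s)))" if q: "q < n * s" for q c
  proof -
    note dm = block_div_mod[OF q]
    have "c * ?x $ q = (\<Sum>k<num_X Q. xb_coeff Q xb (q div s) k * (c * prof_X Q k $ (q mod s)))"
      unfolding x_index[OF q] sum_distrib_left by (intro sum.cong) auto
    also have "\<dots> = (\<Sum>k<num_X Q. \<Sum>j<num_V Q k.
        vb_coeff Q vb (q div s) j k * (c * prof_X Q k $ (q mod s)))"
      using vb_sum[OF dm(1)]
      by (intro sum.cong refl) (simp add: sum_distrib_right[symmetric])
    finally show ?thesis .
  qed
  have lo: "lower P * ?x $ q \<le> ?v $ q" and up: "?v $ q \<le> upper P * ?x $ q"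
    if q: "q < n * s" for q
    unfolding scale[OF q] v_index[OF q] using block_div_mod[OF q]
    by (intro sum_mono mult_left_mono; simp add: vb0 prof_V_bounds)+
  have w0: "0 \<le> ?w $ q" if q: "q < n * s" for q
    unfolding w_index[OF q] using block_div_mod[OF q]
    by (intro sum_nonneg mult_nonneg_nonneg) (simp_all add: wb0 prof_W_nonneg)
  have "binary_vec ?x" using bin by (simp add: binary_vec_def)
  moreover have "lower P \<cdot>\<^sub>v ?x \<le> ?v" "?v \<le> upper P \<cdot>\<^sub>v ?x" "0\<^sub>v (dim_x P) \<le> ?w"
    using lo up w0 by (simp_all add: less_eq_vec_def dim_x_eq)
  moreover have "y \<in> carrier_vec (dim_y P)" "binary_vec y"
    using p by (simp_all add: semi_feasible_def)
  ultimately show ?thesis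
    using rows by (simp add: recon_eq_blockwise_mult milp_feasible_def dim_x_eq)
qed

lemma recon_tight:
  assumes "p \<in> semi_feasible P Q"
  shows "recon Q p \<in> milp_feasible P" and "milp_obj P (recon Q p) = semi_obj P Q p"
proof -
  obtain y xb vb wb where p: "p = (y, xb, vb, wb)" by (rule prod_cases4)
  show "recon Q p \<in> milp_feasible P"
    using semi_feasible_recon assms unfolding p .
  have "xb \<in> carrier_vec (n * num_X Q)" "vb \<in> carrier_vec (n * total_V Q)"
    "wb \<in> carrier_vec (n * num_W Q)"
    using assms by (simp_all add: p semi_feasible_def)
  then show "milp_obj P (recon Q p) = semi_obj P Q p"
    unfolding p by (rule milp_obj_recon)
qed

lemma z_milp_le_z_semi: "z_milp P \<le> z_semi P Q"
  unfolding z_semi_def opt_value_def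
proof (rule INF_greatest)
  fix p assume p: "p \<in> semi_feasible P Q"
  have "z_milp P \<le> ereal (milp_obj P (recon Q p))"
    unfolding z_milp_def opt_value_def by (rule INF_lower[OF recon_tight(1)[OF p]])
  then show "z_milp P \<le> ereal (semi_obj P Q p)"
    unfolding recon_tight(2)[OF p] .
qed


section \<open>Points assembled from profiles lift to the semi-coarse problem\<close>

text \<open>Multiplying by a unit vector picks out a column, so unit vectors as coefficient blocks
  reconstruct any vector whose blocks are columns.\<close>

lemma blockwise_mult_unit_vecs:
  assumes "dim_row Z = s" and "x \<in> carrier_vec (n * s)"
    and "\<And>i. i < n \<Longrightarrow> \<tau> i < dim_col Z"
    and "\<And>i. i < n \<Longrightarrow> col Z (\<tau> i) = vec_block s i x"
  shows "blockwise_mult Q Z (vec_concat n (dim_col Z) (\<lambda>i. unit_vec (dim_col Z) (\<tau> i))) = x"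
proof -
  have "blockwise_mult Q Z (vec_concat n (dim_col Z) (\<lambda>i. unit_vec (dim_col Z) (\<tau> i)))
      = vec_concat n s (\<lambda>i. vec_block s i x)"
    unfolding blockwise_mult_def
    by (intro vec_concat_cong) (simp add: vec_block_vec_concat mat_mult_vec_unit_vec assms)
  also have "\<dots> = x" by (rule vec_concat_vec_block[OF assms(2)])
  finally show ?thesis .
qed

lemma vec_concat_unit_index:
  assumes "i < n" and "t < N" and "\<tau> i < N"
  shows "vec_concat n N (\<lambda>i. unit_vec N (\<tau> i)) $ (i * N + t) = (if t = \<tau> i then 1 else 0)"
  using assms by (simp add: vec_concat_def block_index_less)

text \<open>The coefficients are indicators of one chosen profile per block.  For \<open>v\<close> the chosen column
  must belong to the index \<open>k\<close> chosen for \<open>x\<close>, as otherwise the link between the coefficients of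
  \<open>x\<close> and \<open>v\<close> would break; this is why the \<open>x\<close>- and \<open>v\<close>-profiles of a block have to be included
  as a pair.\<close>

lemma profiles_include_lift:
  assumes feas: "(y, x, v, w) \<in> milp_feasible P" and incl: "profiles_include Q (y, x, v, w)"
  shows "\<exists>p \<in> semi_feasible P Q. recon Q p = (y, x, v, w)"
proof -
  have carr: "x \<in> carrier_vec (n * s)" "v \<in> carrier_vec (n * s)" "w \<in> carrier_vec (n * s)"
    using feas by (simp_all add: milp_feasible_def dim_x_eq)
  have "\<forall>i<n. \<exists>k j. k < num_X Q \<and> j < num_V Q k \<and>
      prof_X Q k = vec_block s i x \<and> prof_V Q j k = vec_block s i v"
    using incl unfolding profiles_include_def by blast
  then obtain \<kappa> \<iota> where
    XV: "\<And>i. i < n \<Longrightarrow> \<kappa> i < num_X Q" "\<And>i. i < n \<Longrightarrow> \<iota> i < num_V Q (\<kappa> i)"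
      "\<And>i. i < n \<Longrightarrow> prof_X Q (\<kappa> i) = vec_block s i x"
      "\<And>i. i < n \<Longrightarrow> prof_V Q (\<iota> i) (\<kappa> i) = vec_block s i v"
    by metis
  have "\<forall>i<n. \<exists>j. j < num_W Q \<and> prof_W Q j = vec_block s i w"
    using incl unfolding profiles_include_def by blast
  then obtain \<omega> where
    W: "\<And>i. i < n \<Longrightarrow> \<omega> i < num_W Q" "\<And>i. i < n \<Longrightarrow> prof_W Q (\<omega> i) = vec_block s i w"
    by metis
  let ?\<nu> = "\<lambda>i. V_offset Q (\<kappa> i) + \<iota> i"
  have \<nu>: "?\<nu> i < total_V Q" if "i < n" for i
    unfolding total_V_def using XV that by (intro V_offset_add_less) auto
  define xb :: "real vec" where "xb = vec_concat n (num_X Q) (\<lambda>i. unit_vec (num_X Q) (\<kappa> i))"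
  define vb :: "real vec" where "vb = vec_concat n (total_V Q) (\<lambda>i. unit_vec (total_V Q) (?\<nu> i))"
  define wb :: "real vec" where "wb = vec_concat n (num_W Q) (\<lambda>i. unit_vec (num_W Q) (\<omega> i))"
  have bcarr: "xb \<in> carrier_vec (n * num_X Q)" "vb \<in> carrier_vec (n * total_V Q)"
    "wb \<in> carrier_vec (n * num_W Q)"
    by (simp_all add: xb_def vb_def wb_def)
  have x: "blockwise_mult Q (X_mat Q) xb = x"
    unfolding xb_def using blockwise_mult_unit_vecs[of "X_mat Q" x \<kappa>] carr XV
    by (simp add: col_X_mat)
  have v: "blockwise_mult Q (V_mat Q) vb = v"
    unfolding vb_def using blockwise_mult_unit_vecs[of "V_mat Q" v ?\<nu>] carr XV \<nu>
    by (simp add: col_V_mat)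
  have w: "blockwise_mult Q (W_mat Q) wb = w"
    unfolding wb_def using blockwise_mult_unit_vecs[of "W_mat Q" w \<omega>] carr W
    by (simp add: col_W_mat)
  have xbc: "xb_coeff Q xb i k = (if k = \<kappa> i then 1 else 0)" if "i < n" "k < num_X Q" for i k
    unfolding xb_coeff_def xb_def using that XV by (simp add: vec_concat_unit_index)
  have wbc: "wb_coeff Q wb i j = (if j = \<omega> i then 1 else 0)" if "i < n" "j < num_W Q" for i j
    unfolding wb_coeff_def wb_def using that W by (simp add: vec_concat_unit_index)
  have vbc: "vb_coeff Q vb i j k = (if k = \<kappa> i then (if j = \<iota> i then 1 else 0) else 0)"
    if "i < n" "k < num_X Q" "j < num_V Q k" for i j k
  proof -
    have "V_offset Q k + j < total_V Q"
      unfolding total_V_def using that by (intro V_offset_add_less) auto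
    then show ?thesis
      unfolding vb_coeff_def vb_def
      using that \<nu> V_offset_add_inject[of j Q k "\<iota> i" "\<kappa> i"] XV
      by (simp add: vec_concat_unit_index)
  qed
  have xs: "(\<Sum>k<num_X Q. xb_coeff Q xb i k) = 1" if "i < n" for i
    using that XV(1)[OF that] by (simp add: xbc)
  have ws: "(\<Sum>j<num_W Q. wb_coeff Q wb i j) = 1" if "i < n" for i
    using that W(1)[OF that] by (simp add: wbc)
  have vs: "(\<Sum>j<num_V Q k. vb_coeff Q vb i j k) = xb_coeff Q xb i k"
    if "i < n" "k < num_X Q" for i k
    using that XV(2)[OF that(1)] by (simp add: vbc xbc)
  have vss: "(\<Sum>k<num_X Q. \<Sum>j<num_V Q k. vb_coeff Q vb i j k) = 1" if "i < n" for i
    using that vs xs by simp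
  have "mat_y P *\<^sub>v y + agg_mat Q (mat_x P) (X_mat Q) *\<^sub>v xb
       + agg_mat Q (mat_v P) (V_mat Q) *\<^sub>v vb + agg_mat Q (mat_w P) (W_mat Q) *\<^sub>v wb \<le> rhs P"
    using feas unfolding constraint_lhs_recon[OF bcarr] x v w by (simp add: milp_feasible_def)
  moreover have "y \<in> carrier_vec (dim_y P)" "binary_vec y"
    using feas by (simp_all add: milp_feasible_def)
  ultimately have "(y, xb, vb, wb) \<in> semi_feasible P Q"
    using bcarr by (simp add: semi_feasible_def xs vs vss ws) (simp add: xbc vbc wbc)
  moreover have "recon Q (y, xb, vb, wb) = (y, x, v, w)"
    by (simp add: recon_eq_blockwise_mult x v w)
  ultimately show ?thesis by blast
qed

text \<open>The tightening makes the optimal value of the original problem a lower bound for every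
  semi-coarse objective value, and \<open>p\<close> attains it.\<close>

lemma equivalent_at_lift:
  assumes opt: "milp_optimal P star" and p: "p \<in> semi_feasible P Q" "recon Q p = star"
  shows "equivalent_at P Q star"
proof -
  have star_min: "milp_obj P star \<le> milp_obj P q" if "q \<in> milp_feasible P" for q
    using opt that by (auto simp: milp_optimal_def is_optimal_def)
  have obj: "semi_obj P Q p = milp_obj P star" using recon_tight(2)[OF p(1)] p(2) by simp
  have "semi_optimal P Q p"
    unfolding semi_optimal_def is_optimal_def
  proof (intro conjI ballI p(1))
    fix q assume "q \<in> semi_feasible P Q"
    from star_min[OF recon_tight(1)[OF this]] recon_tight(2)[OF this]
    show "semi_obj P Q p \<le> semi_obj P Q q" unfolding obj by simp
  qed
  then have zs: "z_semi P Q = ereal (semi_obj P Q p)"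
    unfolding semi_optimal_def z_semi_def by (rule opt_value_is_optimal)
  have zm: "z_milp P = ereal (milp_obj P star)"
    using opt unfolding milp_optimal_def z_milp_def by (rule opt_value_is_optimal)
  have "milp_optimal P (recon Q q)" if q: "semi_optimal P Q q" for q
  proof -
    have qf: "q \<in> semi_feasible P Q" and "semi_obj P Q q \<le> semi_obj P Q p"
      using q p(1) by (auto simp: semi_optimal_def is_optimal_def)
    then have "milp_obj P (recon Q q) \<le> milp_obj P star" using recon_tight(2) obj by simp
    then show ?thesis
      using recon_tight(1)[OF qf] star_min unfolding milp_optimal_def is_optimal_def
      by (meson order_trans)
  qed
  then show ?thesis
    unfolding equivalent_at_def using zs zm obj p by auto
qed

end

theorem proposition2p2:
  fixes P :: milp and Q :: profiles
  assumes "milp_wf P" and "profiles_wf P Q"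
  shows "tightening P Q \<and>
         z_milp P \<le> z_semi P Q \<and>
         (\<forall>ys xs vs ws.
            milp_optimal P (ys, xs, vs, ws) \<longrightarrow>
            profiles_include Q (ys, xs, vs, ws) \<longrightarrow>
            equivalent_at P Q (ys, xs, vs, ws))"
proof (intro conjI allI impI)
  interpret profile_system P Q by unfold_locales (rule assms)+
  show "tightening P Q" unfolding tightening_def using recon_tight by blast
  show "z_milp P \<le> z_semi P Q" by (rule z_milp_le_z_semi)
  fix ys xs vs ws
  assume opt: "milp_optimal P (ys, xs, vs, ws)" and incl: "profiles_include Q (ys, xs, vs, ws)"
  have "(ys, xs, vs, ws) \<in> milp_feasible P"
    using opt by (simp add: milp_optimal_def is_optimal_def)
  from profiles_include_lift[OF this incl] obtain p
    where "p \<in> semi_feasible P Q" "recon Q p = (ys, xs, vs, ws)" by blast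
  then show "equivalent_at P Q (ys, xs, vs, ws)" by (rule equivalent_at_lift[OF opt])
qed

end
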